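(* Let $M$ be a $T_1$ space, let $N$ be a topological space, and let $f\colon M\to N$ be a locally injective continuous map. Let $\ell\ge 1$ and suppose that the distinct points $y_1,\ldots,y_\ell\in f(M)$ are the only multiple points of $f$, i.e. each fibre $f^{-1}(y_i)$ is finite with at least two elements and $f^{-1}(y)$ consists of exactly one point for every $y\in f(M)\setminus\{y_1,\ldots,y_\ell\}$. Put $k_i=|f^{-1}(y_i)|$ for $i=1,\ldots,\ell$. Then $$\mathrm{IC}(f)=\max_{1\leq i\leq \ell} k_i .$$
   Context: "Map" means continuous map. A map $f\colon X\to Y$ is locally injective if each point $x\in X$ has an open neighbourhood $U\subset X$ such that $f_{|U}\colon U\to Y$ is injective. For a locally injective map $f\colon M\to N$, a point $y\in f(M)$ is a $k$th point of $f$ if $f^{-1}(y)$ is a finite set with $k$ elements; a $k$th point with $k\geq 2$ is called a multiple point of $f$. For a map $f\colon X\to Y$, the injective category number $\mathrm{IC}(f)$ is the smallest positive integer $\ell$ such that there are open subsets $U_1,\ldots,U_\ell\subset X$ with $X=U_1\cup\cdots\cup U_\ell$ and each restriction $f_{|U_j}\colon U_j\to Y$ injective; $\mathrm{IC}(f)=\infty$ if no such $\ell$ exists. *)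

theory Defs
  imports "HOL-Analysis.T1_Spaces" "HOL-Library.Extended_Nat"
begin

definition locally_injective :: "'a topology \<Rightarrow> ('a \<Rightarrow> 'b) \<Rightarrow> bool" where
  "locally_injective X f \<longleftrightarrow>
     (\<forall>x \<in> topspace X. \<exists>U. openin X U \<and> x \<in> U \<and> inj_on f U)"

definition fibre :: "'a topology \<Rightarrow> ('a \<Rightarrow> 'b) \<Rightarrow> 'b \<Rightarrow> 'a set" where
  "fibre X f y = {x \<in> topspace X. f x = y}"

definition kth_point :: "'a topology \<Rightarrow> ('a \<Rightarrow> 'b) \<Rightarrow> nat \<Rightarrow> 'b \<Rightarrow> bool" where
  "kth_point X f k y \<longleftrightarrow>
     y \<in> f ` topspace X \<and> finite (fibre X f y) \<and> card (fibre X f y) = k"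

definition multiple_point :: "'a topology \<Rightarrow> ('a \<Rightarrow> 'b) \<Rightarrow> 'b \<Rightarrow> bool" where
  "multiple_point X f y \<longleftrightarrow> (\<exists>k\<ge>2. kth_point X f k y)"

text \<open>The infimum is taken in \<^typ>\<open>enat\<close>: it is the least admissible number of open sets
  if there is one, and \<open>\<infinity>\<close> if there is none. The sets \<open>U j\<close> need not be distinct or nonempty.\<close>

definition injective_category :: "'a topology \<Rightarrow> ('a \<Rightarrow> 'b) \<Rightarrow> enat" where
  "injective_category X f =
     Inf {enat l | l. l \<ge> 1 \<and>
       (\<exists>U :: nat \<Rightarrow> 'a set.
          (\<forall>j \<in> {1..l}. openin X (U j) \<and> inj_on f (U j)) \<and>
          topspace X = (\<Union>j \<in> {1..l}. U j))}"

end

theory Submission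
  imports Defs
begin

text \<open>An open set on which \<open>f\<close> is injective meets each fibre in at most one point, so every
  cover needs at least as many sets as the largest fibre has points. Conversely, number the points
  of each multiple fibre injectively by \<open>1, \<dots>, k\<close> and let \<open>U j\<close> be the complement of all points of
  multiple fibres whose number is not \<open>j\<close>; only finitely many points are removed, so \<open>U j\<close> is
  open in a T1 space.\<close>

lemma card_fibre_le_injective_category:
  assumes "finite (fibre X f z)"
  shows "enat (card (fibre X f z)) \<le> injective_category X f"
  unfolding injective_category_def
\<comment> \<open>It suffices to bound every admissible number of sets from below; with no
  admissible cover the infimum is \<infinity> and there is nothing to check.\<close>
proof (rule Inf_greatest)
  fix n assume "n \<in> {enat l | l. l \<ge> 1 \<and>
       (\<exists>U :: nat \<Rightarrow> 'a set.
          (\<forall>j \<in> {1..l}. openin X (U j) \<and> inj_on f (U j)) \<and>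
          topspace X = (\<Union>j \<in> {1..l}. U j))}"
  then obtain l and U :: "nat \<Rightarrow> 'a set" where n: "n = enat l"
    and inj: "\<And>j. j \<in> {1..l} \<Longrightarrow> inj_on f (U j)"
    and cover: "topspace X = (\<Union>j \<in> {1..l}. U j)"
    by blast
  have "\<forall>x \<in> fibre X f z. \<exists>j \<in> {1..l}. x \<in> U j"
    using cover by (auto simp: fibre_def)
  then obtain h where h: "\<And>x. x \<in> fibre X f z \<Longrightarrow> h x \<in> {1..l} \<and> x \<in> U (h x)"
    by metis
  \<comment> \<open>Two fibre points with the same index lie in one \<open>U j\<close> and share the
    value \<open>z\<close>, so injectivity of \<open>f\<close> on \<open>U j\<close> identifies
    them.\<close>
  have "inj_on h (fibre X f z)"
  proof (rule inj_onI)
    fix a b assume ab: "a \<in> fibre X f z" "b \<in> fibre X f z" "h a = h b"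
    then have "f a = f b"
      by (simp add: fibre_def)
    with ab show "a = b"
      using h[of a] h[of b] inj[of "h a"] by (auto dest: inj_onD)
  qed
  moreover have "h ` fibre X f z \<subseteq> {1..l}"
    using h by blast
  ultimately have "card (fibre X f z) \<le> card {1..l}"
    by (intro card_inj_on_le) auto
  then show "enat (card (fibre X f z)) \<le> n"
    by (simp add: n)
qed

text \<open>Isolates the construction of a cover: \<open>Y\<close> is any finite set of exceptional
  values, to be taken as the set of all \<open>y i\<close>, and \<open>k\<close> any positive bound
  on the sizes of their fibres.\<close>

lemma injective_category_le:
  assumes "t1_space X" and "finite Y" and "k \<ge> 1"
    and fin: "\<And>z. z \<in> Y \<Longrightarrow> finite (fibre X f z)"
    and card_le: "\<And>z. z \<in> Y \<Longrightarrow> card (fibre X f z) \<le> k"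
    and inj: "inj_on f {x \<in> topspace X. f x \<notin> Y}"
  shows "injective_category X f \<le> enat k"
proof -
  have "\<forall>z \<in> Y. \<exists>h. inj_on h (fibre X f z) \<and> h ` fibre X f z \<subseteq> {1..k}"
    using fin card_le by (auto intro!: inj_on_iff_card_le[THEN iffD2])
  then obtain h where h: "\<And>z. z \<in> Y \<Longrightarrow> inj_on (h z) (fibre X f z)"
    "\<And>z. z \<in> Y \<Longrightarrow> h z ` fibre X f z \<subseteq> {1..k}"
    by metis
  \<comment> \<open>Points outside the fibres over \<open>Y\<close> carry no number and stay in
    every \<open>U j\<close>; from each fibre over \<open>Y\<close>, at most one point survives in
    \<open>U j\<close>.\<close>
  define U where "U j = topspace X - {x \<in> topspace X. f x \<in> Y \<and> h (f x) x \<noteq> j}" for j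
  have "openin X (U j)" for j
  proof -
    have "finite (\<Union>z\<in>Y. fibre X f z)"
      using \<open>finite Y\<close> fin by blast
    then have "finite {x \<in> topspace X. f x \<in> Y \<and> h (f x) x \<noteq> j}"
      by (rule rev_finite_subset) (auto simp: fibre_def)
    then have "closedin X {x \<in> topspace X. f x \<in> Y \<and> h (f x) x \<noteq> j}"
      using \<open>t1_space X\<close> by (auto simp: t1_space_closedin_finite)
    then show ?thesis
      unfolding U_def by blast
  qed
  moreover have "inj_on f (U j)" for j
  proof (rule inj_onI)
    fix a b assume ab: "a \<in> U j" "b \<in> U j" "f a = f b"
    show "a = b"
    \<comment> \<open>Over \<open>Y\<close> both points have number \<open>j\<close> in the same
      fibre; elsewhere \<open>f\<close> is injective by assumption.\<close>
    proof (cases "f a \<in> Y")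
      case True
      with ab have "a \<in> fibre X f (f a)" "b \<in> fibre X f (f a)" "h (f a) a = h (f a) b"
        by (auto simp: U_def fibre_def)
      then show ?thesis
        using h(1)[OF True] by (auto dest: inj_onD)
    next
      case False
      with ab show ?thesis
        using inj by (auto simp: U_def dest: inj_onD)
    qed
  qed
  moreover have "topspace X = (\<Union>j \<in> {1..k}. U j)"
  proof
    show "topspace X \<subseteq> (\<Union>j \<in> {1..k}. U j)"
    proof
      fix x assume x: "x \<in> topspace X"
      show "x \<in> (\<Union>j \<in> {1..k}. U j)"
      proof (cases "f x \<in> Y")
        case True
        then have "h (f x) x \<in> {1..k}"
          using h(2)[OF True] x by (auto simp: fibre_def)
        moreover have "x \<in> U (h (f x) x)"
          using x by (simp add: U_def)
        ultimately show ?thesis by blast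
      next
        case False
        \<comment> \<open>Any index would do; 1 is available because \<open>k\<close> is
          positive.\<close>
        then have "x \<in> U 1"
          using x by (simp add: U_def)
        then show ?thesis
          using \<open>k \<ge> 1\<close> by force
      qed
    qed
  qed (auto simp: U_def)
  ultimately show ?thesis
    unfolding injective_category_def using \<open>k \<ge> 1\<close> by (intro Inf_lower) blast
qed

theorem theorem2p10:
  fixes M :: "'a topology" and N :: "'b topology"
    and f :: "'a \<Rightarrow> 'b" and l :: nat and y :: "nat \<Rightarrow> 'b"
  assumes "t1_space M"
    and "continuous_map M N f"
    and "locally_injective M f"
    and "l \<ge> 1"
    and "inj_on y {1..l}"
    and "\<forall>i \<in> {1..l}. multiple_point M f (y i)"
    and "\<forall>z \<in> f ` topspace M - y ` {1..l}. kth_point M f 1 z"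
  shows "injective_category M f = enat (MAX i\<in>{1..l}. card (fibre M f (y i)))"
proof -
  define k where "k = (MAX i\<in>{1..l}. card (fibre M f (y i)))"
  have fin: "finite (fibre M f (y i))" and two: "card (fibre M f (y i)) \<ge> 2" if "i \<in> {1..l}" for i
    using assms(6) that by (auto simp: multiple_point_def kth_point_def)
  have le_k: "card (fibre M f (y i)) \<le> k" if "i \<in> {1..l}" for i
    unfolding k_def using that by (intro Max_ge) auto
  \<comment> \<open>The maximum over the nonempty range is attained; a fibre attaining it yields
    both \<open>k \<ge> 1\<close> and the lower bound.\<close>
  have "k \<in> (\<lambda>i. card (fibre M f (y i))) ` {1..l}"
    unfolding k_def using \<open>l \<ge> 1\<close> by (intro Max_in) auto
  then obtain i where i: "i \<in> {1..l}" "k = card (fibre M f (y i))"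
    by blast
  have "injective_category M f \<le> enat k"
  proof (rule injective_category_le[where Y = "y ` {1..l}"])
    show "k \<ge> 1"
      using two[OF i(1)] i(2) by simp
    show "inj_on f {x \<in> topspace M. f x \<notin> y ` {1..l}}"
    proof (rule inj_onI)
      fix a b
      assume a: "a \<in> {x \<in> topspace M. f x \<notin> y ` {1..l}}"
        and b: "b \<in> {x \<in> topspace M. f x \<notin> y ` {1..l}}" and eq: "f a = f b"
      \<comment> \<open>Away from the values \<open>y i\<close> every fibre is a singleton, and
        \<open>a\<close> and \<open>b\<close> lie in the same one.\<close>
      from a have "card (fibre M f (f a)) = 1"
        using assms(7) by (auto simp: kth_point_def)
      moreover have "a \<in> fibre M f (f a)" "b \<in> fibre M f (f a)"
        using a b eq by (auto simp: fibre_def)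
      ultimately show "a = b"
        by (metis card_1_singletonE singletonD)
    qed
  qed (use assms(1) fin le_k in auto)
  moreover have "enat k \<le> injective_category M f"
    using card_fibre_le_injective_category[OF fin[OF i(1)]] i(2) by simp
  ultimately show ?thesis
    unfolding k_def by (rule antisym)
qed

end
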